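(* Let $V\subseteq\mathbb{R}^d\setminus\{0\}$ be a nonempty finite set such that no two points of $V$ lie in a common 1-dimensional linear subspace. Let $E$ be a finite multiset of triples $\{u,v,w\}$ of distinct points of $V$ lying in a common 2-dimensional linear subspace. Suppose that for every $V'\subseteq V$ with $\dim\operatorname{span}V'\le2$, the number (with multiplicity) of triples of $E$ contained in $V'$ is at most $|V'|-1$. Then for every $\lambda>0$ there exists $V'\subseteq V$ such that, letting $E'$ be the multiset of triples of $E$ contained in $V'$, we have $|E|-|E'|<\lambda|V|$ and $\dim\operatorname{span}V'\le 12|V|/\lambda$. *)

theory Defs
  imports "HOL-Analysis.Analysis" "HOL-Library.Multiset"
begin

definition triples_in :: "'a set multiset \<Rightarrow> 'a set \<Rightarrow> 'a set multiset" where
  "triples_in E W = filter_mset (\<lambda>t. t \<subseteq> W) E"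

end

(* Let c = lam / 12 and let A be a subset of V maximizing |A| - c dim A. Then c dim A <= |V|, and
   after projecting along span A every set S of the remaining points satisfies |S| <= c dim S.
   Under this condition a new inner product, the inverse of I + sum t_i v_i v_i^T with weights t
   obtained from a fixed point argument, makes sum_j cos^2(v_i, v_j) <= 3 lam / 4 for every
   remaining i. On the other hand, in a plane with r points of V that is not contained in span A,
   at most one point lies in span A, and the Welch bound gives r - 1 <= 4/3 * sum cos^2 over the
   ordered pairs of distinct remaining points in the plane. Distinct planes share no such pair, so
   fewer than lam |V| triples are not contained in span A. *)

theory Submission
  imports Defs
begin

section \<open>The frame operator and the quadratic form of its inverse\<close>

definition frame_op :: "'i set \<Rightarrow> ('i \<Rightarrow> 'a::euclidean_space) \<Rightarrow> ('i \<Rightarrow> real) \<Rightarrow> 'a \<Rightarrow> 'a" where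
  "frame_op I w t x = x + (\<Sum>i\<in>I. (t i * (w i \<bullet> x)) *\<^sub>R w i)"

definition frame_inv :: "'i set \<Rightarrow> ('i \<Rightarrow> 'a::euclidean_space) \<Rightarrow> ('i \<Rightarrow> real) \<Rightarrow> 'a \<Rightarrow> 'a" where
  "frame_inv I w t = inv (frame_op I w t)"

lemma inner_frame_op:
  "y \<bullet> frame_op I w t x = y \<bullet> x + (\<Sum>i\<in>I. t i * (w i \<bullet> x) * (w i \<bullet> y))"
  by (simp add: frame_op_def inner_add_right inner_sum_right inner_commute)

lemma frame_op_selfadjoint: "y \<bullet> frame_op I w t x = frame_op I w t y \<bullet> x"
  by (subst (2) inner_commute) (simp add: inner_frame_op inner_commute mult_ac)

lemma linear_frame_op: "linear (frame_op I w t)"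
  by (rule linearI)
    (simp_all add: frame_op_def inner_add_right distrib_left scaleR_left_distrib sum.distrib
      scaleR_right_distrib scaleR_sum_right mult_ac)

lemma frame_op_ge:
  assumes "\<And>i. 0 \<le> t i"
  shows "x \<bullet> x \<le> x \<bullet> frame_op I w t x"
proof -
  have "0 \<le> (\<Sum>i\<in>I. t i * (w i \<bullet> x) * (w i \<bullet> x))"
    using assms by (intro sum_nonneg) (simp add: mult.assoc)
  then show ?thesis by (simp add: inner_frame_op)
qed

lemma frame_op_mono:
  assumes "\<And>i. t i \<le> t' i"
  shows "x \<bullet> frame_op I w t x \<le> x \<bullet> frame_op I w t' x"
  unfolding inner_frame_op mult.assoc
  by (intro add_left_mono sum_mono mult_right_mono assms) simp

lemma bij_frame_op:
  assumes "\<And>i. 0 \<le> t i"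
  shows "bij (frame_op I w t)"
proof -
  have "x = 0" if "frame_op I w t x = 0" for x
    using frame_op_ge[of t x I w] assms that inner_gt_zero_iff[of x] by fastforce
  then have "inj (frame_op I w t)"
    using linear_injective_0[OF linear_frame_op] by blast
  then show ?thesis
    using linear_injective_imp_surjective[OF linear_frame_op] by (simp add: bij_def)
qed

lemma frame_op_inv:
  assumes "\<And>i. 0 \<le> t i"
  shows "frame_op I w t (frame_inv I w t x) = x"
  unfolding frame_inv_def using bij_frame_op[of t I w] assms
  by (simp add: bij_is_surj surj_f_inv_f)

lemma frame_inv_op:
  assumes "\<And>i. 0 \<le> t i"
  shows "frame_inv I w t (frame_op I w t x) = x"
  unfolding frame_inv_def using bij_frame_op[of t I w] assms
  by (simp add: bij_is_inj)

lemma linear_frame_inv: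
  assumes "\<And>i. 0 \<le> t i"
  shows "linear (frame_inv I w t)"
proof (rule linearI)
  note lin = linear_add[OF linear_frame_op] linear_cmul[OF linear_frame_op]
  note fi = frame_op_inv[of t I w, OF assms] frame_inv_op[of t I w, OF assms]
  show "frame_inv I w t (x + y) = frame_inv I w t x + frame_inv I w t y" for x y
    by (metis fi lin(1))
  show "frame_inv I w t (r *\<^sub>R x) = r *\<^sub>R frame_inv I w t x" for r x
    by (metis fi lin(2))
qed

lemma frame_inv_selfadjoint:
  assumes "\<And>i. 0 \<le> t i"
  shows "x \<bullet> frame_inv I w t y = frame_inv I w t x \<bullet> y"
  by (metis frame_op_inv[of t I w, OF assms] frame_op_selfadjoint)

lemma norm_frame_inv_le:
  assumes "\<And>i. 0 \<le> t i"
  shows "frame_inv I w t x \<bullet> frame_inv I w t x \<le> x \<bullet> frame_inv I w t x"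
  by (metis assms frame_op_ge frame_op_inv inner_commute)

lemma frame_inv_pos:
  assumes "\<And>i. 0 \<le> t i" and "x \<noteq> 0"
  shows "0 < x \<bullet> frame_inv I w t x"
proof -
  have "frame_inv I w t x \<noteq> 0"
    using frame_op_inv[of t I w x, OF assms(1)] linear_0[OF linear_frame_op] assms(2) by metis
  then show ?thesis
    using norm_frame_inv_le[of t I w x] assms(1) by (smt (verit) inner_gt_zero_iff)
qed

text \<open>Let \<open>F\<close> be the operator with weights \<open>t\<close>, and let
  \<open>y\<close>, \<open>y'\<close> be the images of \<open>x\<close> under the two inverses.
  Expanding the nonnegative form of \<open>F\<close> at \<open>y - y'\<close> gives
  \<open>y \<bullet> x - 2 * (y' \<bullet> x) + y' \<bullet> F y'\<close>, and monotonicity of the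
  operators bounds the last term by \<open>y' \<bullet> x\<close>.\<close>

lemma frame_inv_antimono:
  assumes t: "\<And>i. 0 \<le> t i" and le: "\<And>i. t i \<le> t' i"
  shows "x \<bullet> frame_inv I w t' x \<le> x \<bullet> frame_inv I w t x"
proof -
  define y where "y = frame_inv I w t x"
  define y' where "y' = frame_inv I w t' x"
  have t': "0 \<le> t' i" for i using t le order_trans by blast
  have y: "frame_op I w t y = x" and y': "frame_op I w t' y' = x"
    using t t' by (simp_all add: y_def y'_def frame_op_inv)
  have "y' \<bullet> frame_op I w t y' \<le> y' \<bullet> x"
    using frame_op_mono[of t t' y' I w] le y' by simp
  moreover have "0 \<le> (y - y') \<bullet> frame_op I w t (y - y')"
    using frame_op_ge[of t "y - y'" I w] t inner_ge_zero order_trans by blast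
  moreover have "(y - y') \<bullet> frame_op I w t (y - y')
      = y \<bullet> x - 2 * (y' \<bullet> x) + y' \<bullet> frame_op I w t y'"
    using frame_op_selfadjoint[of y I w t y'] y
    by (simp add: linear_diff[OF linear_frame_op] inner_diff_left inner_diff_right inner_commute)
  ultimately show ?thesis
    by (simp add: y_def y'_def inner_commute)
qed

text \<open>With \<open>y\<close> the preimage of \<open>x\<close>, the form
  \<open>y \<bullet> x\<close> is the weighted sum plus \<open>y \<bullet> y\<close>, which is
  dropped. This inequality later turns balanced weights into bounds on correlation sums.\<close>

lemma frame_inv_sum_squares:
  assumes t: "\<And>i. 0 \<le> t i"
  shows "(\<Sum>j\<in>I. t j * (w j \<bullet> frame_inv I w t x)\<^sup>2) \<le> x \<bullet> frame_inv I w t x"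
proof -
  define y where "y = frame_inv I w t x"
  have "y \<bullet> x = y \<bullet> frame_op I w t y"
    using t by (simp add: y_def frame_op_inv)
  also have "\<dots> = y \<bullet> y + (\<Sum>j\<in>I. t j * (w j \<bullet> y)\<^sup>2)"
    by (simp add: inner_frame_op power2_eq_square mult.assoc)
  finally show ?thesis
    by (simp add: y_def inner_commute)
qed

lemma span_image_sum:
  assumes "finite U" and "x \<in> span (w ` U)"
  shows "\<exists>a. x = (\<Sum>i\<in>U. a i *\<^sub>R w i)"
  using assms(2)
proof (induction rule: span_induct_alt)
  case base
  show ?case by (rule exI[of _ "\<lambda>_. 0"]) simp
next
  case (step c x y)
  then obtain a j where a: "y = (\<Sum>i\<in>U. a i *\<^sub>R w i)" and j: "j \<in> U" "x = w j"
    by blast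
  have "(\<Sum>i\<in>U. (a i + (if i = j then c else 0)) *\<^sub>R w i)
      = y + (\<Sum>i\<in>U. if i = j then c *\<^sub>R w i else 0)"
    by (simp add: a scaleR_left_distrib sum.distrib if_distrib[of "\<lambda>c. c *\<^sub>R _"] cong: if_cong)
  also have "\<dots> = c *\<^sub>R x + y"
    using assms(1) j by simp
  finally show ?case by metis
qed

lemma frame_inv_span_small:
  fixes w :: "'i \<Rightarrow> 'a::euclidean_space"
  assumes fin: "finite I" and U: "U \<subseteq> I" and e: "e \<in> span (w ` U)"
  shows "\<exists>\<alpha>\<ge>0. \<forall>t R. (\<forall>i. 0 \<le> t i) \<longrightarrow> R > 0 \<longrightarrow> (\<forall>i\<in>U. R \<le> t i) \<longrightarrow>
      e \<bullet> frame_inv I w t e \<le> \<alpha> / R"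
proof -
  have finU: "finite U" using fin U finite_subset by blast
  obtain a where a: "e = (\<Sum>i\<in>U. a i *\<^sub>R w i)"
    using span_image_sum[OF finU e] by blast
  define \<alpha> where "\<alpha> = (\<Sum>i\<in>U. (a i)\<^sup>2)"
  have "e \<bullet> frame_inv I w t e \<le> \<alpha> / R"
    if t: "\<And>i. 0 \<le> t i" and R: "R > 0" and tR: "\<And>i. i \<in> U \<Longrightarrow> R \<le> t i" for t R
  proof -
    define x where "x = frame_inv I w t e"
    define S where "S = (\<Sum>i\<in>U. (w i \<bullet> x)\<^sup>2)"
    have "e \<bullet> x = (\<Sum>i\<in>U. a i * (w i \<bullet> x))"
      by (simp add: a inner_sum_left)
    then have 1: "(e \<bullet> x)\<^sup>2 \<le> \<alpha> * S"
      using Cauchy_Schwarz_ineq_sum[of a "\<lambda>i. w i \<bullet> x" U] by (simp add: \<alpha>_def S_def)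
    have "R * S \<le> (\<Sum>i\<in>U. t i * (w i \<bullet> x)\<^sup>2)"
      unfolding S_def sum_distrib_left by (intro sum_mono mult_right_mono tR) auto
    also have "\<dots> \<le> (\<Sum>i\<in>I. t i * (w i \<bullet> x)\<^sup>2)"
      using fin U t by (intro sum_mono2) auto
    also have "\<dots> \<le> e \<bullet> x"
      unfolding x_def by (rule frame_inv_sum_squares[OF t])
    finally have 2: "R * S \<le> e \<bullet> x" .
    have "\<alpha> \<ge> 0" by (simp add: \<alpha>_def sum_nonneg)
    have "R * (e \<bullet> x)\<^sup>2 \<le> \<alpha> * (R * S)"
      using mult_left_mono[OF 1, of R] R by (simp add: mult_ac)
    also have "\<dots> \<le> \<alpha> * (e \<bullet> x)"
      using 2 \<open>\<alpha> \<ge> 0\<close> by (rule mult_left_mono)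
    finally have 3: "(R * (e \<bullet> x)) * (e \<bullet> x) \<le> \<alpha> * (e \<bullet> x)"
      by (simp add: power2_eq_square mult_ac)
    \<comment> \<open>One factor \<open>e \<bullet> x\<close> is cancelled when it is positive;
      otherwise the left side is at most 0.\<close>
    have "R * (e \<bullet> x) \<le> \<alpha>"
    proof (cases "e \<bullet> x > 0")
      case True
      then show ?thesis using 3 by simp
    next
      case False
      then show ?thesis using R \<open>\<alpha> \<ge> 0\<close>
        by (smt (verit) mult_nonneg_nonpos)
    qed
    then show ?thesis
      using R by (simp add: x_def field_simps)
  qed
  moreover have "\<alpha> \<ge> 0" by (simp add: \<alpha>_def sum_nonneg)
  ultimately show ?thesis by blast
qed

text \<open>Both sides are the trace of the inverse composed with the part of the operator coming
  from \<open>U\<close>. That part is the difference of the operators for \<open>I\<close> and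
  \<open>I - U\<close>; the first of these cancels against the inverse and contributes 1 for each
  basis vector. Since \<open>span B\<close> contains the vectors of \<open>U\<close>, summing over
  \<open>B\<close> captures the whole trace.\<close>

lemma frame_inv_trace:
  fixes w :: "'i \<Rightarrow> 'a::euclidean_space"
  assumes t: "\<And>i. 0 \<le> t i" and fin: "finite I" and U: "U \<subseteq> I"
    and B: "pairwise orthogonal B" "\<And>e. e \<in> B \<Longrightarrow> norm e = 1" "finite B" "w ` U \<subseteq> span B"
  shows "(\<Sum>i\<in>U. t i * (w i \<bullet> frame_inv I w t (w i)))
    = (\<Sum>e\<in>B. 1 - frame_inv I w t e \<bullet> frame_op (I - U) w t e)"
proof -
  let ?H = "frame_inv I w t"
  have exp: "w i \<bullet> ?H (w i) = (\<Sum>e\<in>B. (w i \<bullet> e) * (w i \<bullet> ?H e))" if "i \<in> U" for i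
  proof -
    have "w i \<in> span B" using that B(4) by blast
    then have "w i = (\<Sum>e\<in>B. (w i \<bullet> e) *\<^sub>R e)"
      using orthonormal_basis_expand[of B "w i"] B by simp
    then have "w i \<bullet> ?H (w i) = (\<Sum>e\<in>B. (w i \<bullet> e) *\<^sub>R e) \<bullet> ?H (w i)" by simp
    also have "\<dots> = (\<Sum>e\<in>B. (w i \<bullet> e) * (e \<bullet> ?H (w i)))"
      by (simp add: inner_sum_left)
    also have "\<dots> = (\<Sum>e\<in>B. (w i \<bullet> e) * (w i \<bullet> ?H e))"
      by (intro sum.cong refl)
        (metis frame_inv_selfadjoint[where t=t and I=I and w=w, OF t] inner_commute)
    finally show ?thesis .
  qed
  have one: "1 - ?H e \<bullet> frame_op (I - U) w t e = (\<Sum>i\<in>U. t i * (w i \<bullet> e) * (w i \<bullet> ?H e))"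
    if "e \<in> B" for e
  proof -
    have "1 = e \<bullet> e" using B(2)[OF that] by (simp add: norm_eq_1)
    also have "\<dots> = ?H e \<bullet> frame_op I w t e"
      by (metis frame_inv_selfadjoint[where t=t and I=I and w=w, OF t] frame_inv_op[of t I w, OF t])
    also have "\<dots> = ?H e \<bullet> frame_op (I - U) w t e + (\<Sum>i\<in>U. t i * (w i \<bullet> e) * (w i \<bullet> ?H e))"
      unfolding inner_frame_op by (subst sum.subset_diff[OF U fin]) simp
    finally show ?thesis by simp
  qed
  have "(\<Sum>i\<in>U. t i * (w i \<bullet> ?H (w i))) = (\<Sum>i\<in>U. \<Sum>e\<in>B. t i * (w i \<bullet> e) * (w i \<bullet> ?H e))"
    by (intro sum.cong refl) (simp add: exp sum_distrib_left mult.assoc)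
  also have "\<dots> = (\<Sum>e\<in>B. \<Sum>i\<in>U. t i * (w i \<bullet> e) * (w i \<bullet> ?H e))"
    by (rule sum.swap)
  also have "\<dots> = (\<Sum>e\<in>B. 1 - ?H e \<bullet> frame_op (I - U) w t e)"
    by (intro sum.cong refl) (simp add: one)
  finally show ?thesis .
qed

section \<open>Existence of balanced weights\<close>

definition subbalanced :: "'i set \<Rightarrow> ('i \<Rightarrow> 'a::euclidean_space) \<Rightarrow> real \<Rightarrow> ('i \<Rightarrow> real) set" where
  "subbalanced I w b = {t. (\<forall>i. 0 \<le> t i) \<and> (\<forall>i\<in>I. t i * (w i \<bullet> frame_inv I w t (w i)) \<le> b)}"

text \<open>Raising weights only lowers the inverse form, so at each index the bound is inherited
  from whichever weight attains the maximum. Closure under maxima allows several weights to be made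
  large simultaneously.\<close>

lemma subbalanced_max:
  assumes "t \<in> subbalanced I w b" and "t' \<in> subbalanced I w b"
  shows "(\<lambda>i. max (t i) (t' i)) \<in> subbalanced I w b"
proof -
  let ?m = "\<lambda>i. max (t i) (t' i)"
  have t: "0 \<le> t i" "0 \<le> t' i" for i
    using assms by (auto simp: subbalanced_def)
  have "?m i * (w i \<bullet> frame_inv I w ?m (w i)) \<le> b" if i: "i \<in> I" for i
  proof -
    have "w i \<bullet> frame_inv I w ?m (w i) \<le> w i \<bullet> frame_inv I w t (w i)"
         "w i \<bullet> frame_inv I w ?m (w i) \<le> w i \<bullet> frame_inv I w t' (w i)"
      by (rule frame_inv_antimono; simp add: t)+
    then have "t i * (w i \<bullet> frame_inv I w ?m (w i)) \<le> b" "t' i * (w i \<bullet> frame_inv I w ?m (w i)) \<le> b"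
      using assms i t by (auto simp: subbalanced_def intro: order_trans[OF mult_left_mono])
    then show ?thesis by (simp add: max_def)
  qed
  then show ?thesis using t by (auto simp: subbalanced_def le_max_iff_disj)
qed

text \<open>If the weights on a nonempty set \<open>U\<close> could all be arbitrarily large while
  the others stay bounded, the trace over \<open>U\<close> would approach \<open>dim (w\<close>
  U)\<open>. Subbalancedness keeps it at most\<close>b * card U\<open>, hence at most\<close>b * c *
  dim (w \<open>U)\<close>, and \<open>b * c < 1\<close> makes this a contradiction.\<close>

lemma subbalanced_bdd_above:
  fixes w :: "'i \<Rightarrow> 'a::euclidean_space"
  assumes fin: "finite I" and w0: "\<And>i. i \<in> I \<Longrightarrow> w i \<noteq> 0"
    and dim: "\<And>S. S \<subseteq> I \<Longrightarrow> real (card S) \<le> c * real (dim (w ` S))"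
    and b: "0 < b" and bc: "b * c < 1" and i: "i \<in> I"
  shows "bdd_above ((\<lambda>t. t i) ` subbalanced I w b)"
proof (rule ccontr)
  assume unb: "\<not> ?thesis"
  let ?T = "subbalanced I w b"
  \<comment> \<open>All unbounded coordinates are collected, so that the remaining weights have
    bounds \<open>K\<close> uniform in \<open>t\<close>.\<close>
  define U where "U = {i \<in> I. \<not> bdd_above ((\<lambda>t. t i) ` ?T)}"
  have U: "U \<subseteq> I" and iU: "i \<in> U" using unb i by (auto simp: U_def)
  have finU: "finite U" using U fin finite_subset by blast
  have "\<forall>j\<in>I - U. \<exists>K. \<forall>t\<in>?T. t j \<le> K"
    by (auto simp: U_def bdd_above_def)
  then obtain K where K: "\<And>j t. j \<in> I - U \<Longrightarrow> t \<in> ?T \<Longrightarrow> t j \<le> K j"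
    by metis
  \<comment> \<open>This bounds the norm of \<open>frame_op (I - U) w t e\<close> for every unit
    vector \<open>e\<close> and every subbalanced \<open>t\<close>.\<close>
  define C where "C = 1 + (\<Sum>j\<in>I - U. K j * (norm (w j))\<^sup>2)"
  have zero: "(\<lambda>_. 0) \<in> ?T" using b by (simp add: subbalanced_def)
  have large: "\<exists>t\<in>?T. \<forall>i\<in>F. R \<le> t i" if "finite F" "F \<subseteq> U" for R F
    using that
  proof (induction F)
    case empty
    then show ?case using zero by auto
  next
    case (insert j F)
    then obtain t where t: "t \<in> ?T" "\<forall>i\<in>F. R \<le> t i" by auto
    have "\<exists>t'\<in>?T. R < t' j"
      using insert.prems by (auto simp: U_def bdd_above_def not_le)
    then obtain t' where t': "t' \<in> ?T" "R < t' j" by blast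
    show ?case
      using t t' by (intro bexI[OF _ subbalanced_max[OF t(1) t'(1)]]) auto
  qed
  obtain B where B: "B \<subseteq> span (w ` U)" "pairwise orthogonal B" "\<And>e. e \<in> B \<Longrightarrow> norm e = 1"
    "independent B" "card B = dim (span (w ` U))" "span B = span (w ` U)"
    using orthonormal_basis_subspace[OF subspace_span] by metis
  have finB: "finite B" using B(4) by (rule independent_imp_finite)
  have "w i \<in> span B" using iU B(6) by (auto intro: span_base)
  then have "B \<noteq> {}" using w0[OF i] by auto
  have "\<forall>e\<in>B. \<exists>\<alpha>\<ge>0. \<forall>t R. (\<forall>i. 0 \<le> t i) \<longrightarrow> R > 0 \<longrightarrow> (\<forall>i\<in>U. R \<le> t i) \<longrightarrow>
      e \<bullet> frame_inv I w t e \<le> \<alpha> / R"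
    using frame_inv_span_small[OF fin U] B(1) by blast
  then obtain \<alpha> where \<alpha>: "\<And>e. e \<in> B \<Longrightarrow> \<alpha> e \<ge> 0"
    "\<And>e t R. e \<in> B \<Longrightarrow> (\<And>i. 0 \<le> t i) \<Longrightarrow> R > 0 \<Longrightarrow> (\<And>i. i \<in> U \<Longrightarrow> R \<le> t i) \<Longrightarrow>
      e \<bullet> frame_inv I w t e \<le> \<alpha> e / R"
    by metis
  define \<delta> where "\<delta> = 1 - b * c"
  have \<delta>: "\<delta> > 0" using bc by (simp add: \<delta>_def)
  \<comment> \<open>Below, the norm of the inverse at \<open>e\<close> is at most the square root of
    \<open>sum \<alpha> B / R\<close>. This \<open>R\<close> makes that root times \<open>C\<close>
    smaller than \<open>\<delta>\<close>; the added 1 gives strictness and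
    \<open>R > 0\<close>.\<close>
  define R where "R = C\<^sup>2 * sum \<alpha> B / \<delta>\<^sup>2 + 1"
  have \<alpha>0: "sum \<alpha> B \<ge> 0" using \<alpha>(1) by (simp add: sum_nonneg)
  then have R: "R > 0" using \<delta> by (simp add: R_def add_nonneg_pos)
  have CR: "C\<^sup>2 * sum \<alpha> B < \<delta>\<^sup>2 * R"
    using \<delta> by (simp add: R_def field_simps)
  obtain t where t: "t \<in> ?T" "\<And>i. i \<in> U \<Longrightarrow> R \<le> t i"
    using large[OF finU order_refl] by blast
  have t0: "\<And>i. 0 \<le> t i" using t(1) by (simp add: subbalanced_def)
  have err: "frame_inv I w t e \<bullet> frame_op (I - U) w t e < \<delta>" if e: "e \<in> B" for e
  proof -
    let ?x = "frame_inv I w t e"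
    have "?x \<bullet> ?x \<le> e \<bullet> ?x"
      by (rule norm_frame_inv_le[OF t0])
    also have "\<dots> \<le> \<alpha> e / R"
      using t0 t(2) by (intro \<alpha>(2)[OF e _ R])
    also have "\<dots> \<le> sum \<alpha> B / R"
      using R \<alpha>(1) e finB by (intro divide_right_mono member_le_sum) auto
    finally have x: "(norm ?x)\<^sup>2 \<le> sum \<alpha> B / R" by (simp add: power2_norm_eq_inner)
    have "norm (frame_op (I - U) w t e) \<le> norm e + (\<Sum>j\<in>I - U. norm ((t j * (w j \<bullet> e)) *\<^sub>R w j))"
      unfolding frame_op_def by (intro norm_triangle_mono order_refl norm_sum)
    also have "\<dots> \<le> C"
      unfolding C_def B(3)[OF e]
    proof (intro add_left_mono sum_mono)
      fix j assume j: "j \<in> I - U"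
      have "\<bar>w j \<bullet> e\<bar> \<le> norm (w j)"
        using Cauchy_Schwarz_ineq2[of "w j" e] B(3)[OF e] by simp
      moreover have "\<bar>t j\<bar> \<le> K j" using K[OF j t(1)] t0 by simp
      ultimately show "norm ((t j * (w j \<bullet> e)) *\<^sub>R w j) \<le> K j * (norm (w j))\<^sup>2"
        by (simp add: abs_mult power2_eq_square mult.assoc mult_mono mult_right_mono)
    qed
    finally have y: "norm (frame_op (I - U) w t e) \<le> C" .
    then have C: "C \<ge> 0" using norm_ge_zero order_trans by blast
    have "(norm ?x * C)\<^sup>2 \<le> sum \<alpha> B / R * C\<^sup>2"
      unfolding power_mult_distrib by (intro mult_right_mono x) simp
    also have "\<dots> < \<delta>\<^sup>2" using CR R by (simp add: field_simps)
    finally have "norm ?x * C < \<delta>"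
      using \<delta> power2_less_imp_less less_imp_le by blast
    moreover have "?x \<bullet> frame_op (I - U) w t e \<le> norm ?x * norm (frame_op (I - U) w t e)"
      by (rule norm_cauchy_schwarz)
    moreover have "\<dots> \<le> norm ?x * C" using y by (simp add: mult_left_mono)
    ultimately show ?thesis by linarith
  qed
  \<comment> \<open>Each summand of the trace exceeds \<open>1 - \<delta> = b * c\<close>, so the
    chain runs from \<open>b * c * card B\<close> strictly upwards and back to itself.\<close>
  have "b * c * card B = (\<Sum>e\<in>B. 1 - \<delta>)" by (simp add: \<delta>_def)
  also have "\<dots> < (\<Sum>e\<in>B. 1 - frame_inv I w t e \<bullet> frame_op (I - U) w t e)"
    using err finB \<open>B \<noteq> {}\<close> by (intro sum_strict_mono) auto
  also have "\<dots> = (\<Sum>i\<in>U. t i * (w i \<bullet> frame_inv I w t (w i)))"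
  proof (rule frame_inv_trace[symmetric])
    show "w ` U \<subseteq> span B" by (simp add: B(6) span_superset)
  qed (use t0 fin U B finB in auto)
  also have "\<dots> \<le> (\<Sum>i\<in>U. b)"
    using t(1) U by (intro sum_mono) (auto simp: subbalanced_def)
  also have "\<dots> = b * card U" by simp
  also have "\<dots> \<le> b * (c * dim (w ` U))"
    using dim[OF U] b by (intro mult_left_mono) auto
  also have "\<dots> = b * c * card B"
    by (simp add: B(5) dim_span)
  finally show False by simp
qed

text \<open>\<open>subbalanced I w b\<close> is the set of points below their image under the monotone map
  \<open>t \<mapsto> b / (w i \<bullet> frame_inv I w t (w i))\<close>, so its supremum is a fixed point.\<close>

lemma exists_balanced:
  fixes w :: "'i \<Rightarrow> 'a::euclidean_space"
  assumes fin: "finite I" and w0: "\<And>i. i \<in> I \<Longrightarrow> w i \<noteq> 0"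
    and dim: "\<And>S. S \<subseteq> I \<Longrightarrow> real (card S) \<le> c * real (dim (w ` S))"
    and b: "0 < b" and bc: "b * c < 1"
  shows "\<exists>t. (\<forall>i. 0 \<le> t i) \<and> (\<forall>i\<in>I. t i * (w i \<bullet> frame_inv I w t (w i)) = b)"
proof -
  let ?T = "subbalanced I w b"
  \<comment> \<open>Outside \<open>I\<close> the weights are unbounded in \<open>?T\<close>, so the
    supremum is replaced there by 0.\<close>
  define s where "s i = (if i \<in> I then SUP t\<in>?T. t i else 0)" for i
  define G where "G t i = w i \<bullet> frame_inv I w t (w i)" for t i
  have bdd: "bdd_above ((\<lambda>t. t i) ` ?T)" if "i \<in> I" for i
    by (rule subbalanced_bdd_above[OF fin _ _ b bc that]; rule w0 dim; assumption)
  have zero: "(\<lambda>_. 0) \<in> ?T" using b by (simp add: subbalanced_def)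
  have up: "t i \<le> s i" if "t \<in> ?T" "i \<in> I" for t i
    using cSUP_upper[OF that(1) bdd[OF that(2)]] that(2) by (simp add: s_def)
  have s0: "0 \<le> s i" for i
    using up[OF zero] by (cases "i \<in> I") (auto simp: s_def)
  have Gpos: "0 < G t i" if "\<And>i. 0 \<le> t i" "i \<in> I" for t i
    unfolding G_def by (rule frame_inv_pos[OF that(1) w0[OF that(2)]])
  have Gs: "0 < G s i" if "i \<in> I" for i
    using Gpos s0 that by blast
  have Gmono: "G t' i \<le> G t i" if "\<And>i. 0 \<le> t i" "\<And>i. i \<in> I \<Longrightarrow> t i \<le> t' i" for t t' i
  proof -
    \<comment> \<open>The operator sees only weights on \<open>I\<close>. Truncating to 0 elsewhere
      makes \<open>frame_inv_antimono\<close>, which compares weights at all indices,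
      applicable.\<close>
    have [simp]: "frame_inv I w (\<lambda>i. if i \<in> I then r i else 0) = frame_inv I w r" for r
      unfolding frame_inv_def frame_op_def by simp
    show ?thesis
      using frame_inv_antimono[of "\<lambda>i. if i \<in> I then t i else 0" "\<lambda>i. if i \<in> I then t' i else 0"
        "w i" I w] that by (simp add: G_def)
  qed
  have sub: "s i * G s i \<le> b" if i: "i \<in> I" for i
  proof -
    have "t i \<le> b / G s i" if t: "t \<in> ?T" for t
    proof -
      have t0: "\<And>i. 0 \<le> t i" using t by (simp add: subbalanced_def)
      have "t i * G s i \<le> t i * G t i"
        using Gmono[of t s i] t0 up[OF t] by (intro mult_left_mono) auto
      also have "\<dots> \<le> b" using t i by (simp add: subbalanced_def G_def)
      finally show ?thesis using Gs[OF i] by (simp add: field_simps)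
    qed
    then have "s i \<le> b / G s i"
      using zero i by (auto simp: s_def intro!: cSUP_least)
    then show ?thesis using Gs[OF i] by (simp add: field_simps)
  qed
  \<comment> \<open>\<open>f\<close> is the image of \<open>s\<close> under the monotone map. It
    lies above \<open>s\<close> and is again subbalanced, hence also below the supremum
    \<open>s\<close>; so the two agree on \<open>I\<close>.\<close>
  define f where "f i = (if i \<in> I then b / G s i else 0)" for i
  have sf: "s i \<le> f i" if "i \<in> I" for i
    using sub[OF that] Gs[OF that] that by (simp add: f_def field_simps)
  have f0: "0 \<le> f i" for i
    using Gs[of i] b by (auto simp: f_def)
  have "f i * G f i \<le> b" if i: "i \<in> I" for i
  proof -
    have "f i * G f i \<le> f i * G s i"
      using Gmono[of s f i] s0 sf f0 by (intro mult_left_mono) auto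
    also have "\<dots> = b" using Gs[OF i] i by (simp add: f_def)
    finally show ?thesis .
  qed
  then have "f \<in> ?T" using f0 by (simp add: subbalanced_def G_def)
  then have "s i = f i" if "i \<in> I" for i
    using up[of f i] sf[of i] that by force
  then have "s i * G s i = b" if "i \<in> I" for i
    using Gs[OF that] that by (simp add: f_def)
  then show ?thesis using s0 unfolding G_def by blast
qed

text \<open>Take \<open>H\<close> to be the inverse operator for balanced weights. Then
  \<open>1 / (w j \<bullet> H (w j))\<close> equals \<open>t j / b\<close>, so the correlation sum
  is a weighted sum of squares to which \<open>frame_inv_sum_squares\<close> applies.\<close>

lemma exists_small_correlations:
  fixes w :: "'i \<Rightarrow> 'a::euclidean_space"
  assumes fin: "finite I" and w0: "\<And>i. i \<in> I \<Longrightarrow> w i \<noteq> 0"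
    and dim: "\<And>S. S \<subseteq> I \<Longrightarrow> real (card S) \<le> c * real (dim (w ` S))"
    and b: "0 < b" and bc: "b * c < 1"
  shows "\<exists>H. linear H \<and> (\<forall>x y. x \<bullet> H y = H x \<bullet> y) \<and> (\<forall>x. x \<noteq> 0 \<longrightarrow> 0 < x \<bullet> H x) \<and>
    (\<forall>i\<in>I. (\<Sum>j\<in>I. (w i \<bullet> H (w j))\<^sup>2 / ((w i \<bullet> H (w i)) * (w j \<bullet> H (w j)))) \<le> 1 / b)"
proof -
  obtain t where t: "\<And>i. 0 \<le> t i" and eq: "\<And>i. i \<in> I \<Longrightarrow> t i * (w i \<bullet> frame_inv I w t (w i)) = b"
    using exists_balanced[OF fin _ _ b bc, of w] w0 dim by blast
  let ?H = "frame_inv I w t"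
  have pos: "0 < x \<bullet> ?H x" if "x \<noteq> 0" for x
    by (rule frame_inv_pos[where t=t, OF t that])
  note sa = frame_inv_selfadjoint[where t=t and I=I and w=w, OF t]
  have "(\<Sum>j\<in>I. (w i \<bullet> ?H (w j))\<^sup>2 / ((w i \<bullet> ?H (w i)) * (w j \<bullet> ?H (w j)))) \<le> 1 / b"
    if i: "i \<in> I" for i
  proof -
    have g: "0 < w j \<bullet> ?H (w j)" if "j \<in> I" for j
      using pos w0[OF that] .
    have "(\<Sum>j\<in>I. (w i \<bullet> ?H (w j))\<^sup>2 / ((w i \<bullet> ?H (w i)) * (w j \<bullet> ?H (w j))))
      = (\<Sum>j\<in>I. t j * (w j \<bullet> ?H (w i))\<^sup>2) / ((w i \<bullet> ?H (w i)) * b)"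
      unfolding sum_divide_distrib
    proof (rule sum.cong[OF refl])
      fix j assume j: "j \<in> I"
      have "w i \<bullet> ?H (w j) = w j \<bullet> ?H (w i)"
        using sa[of "w i" "w j"] by (simp add: inner_commute)
      moreover have "b \<noteq> 0" "t j = b / (w j \<bullet> ?H (w j))"
        using b eq[OF j] g[OF j] by (simp_all add: nonzero_eq_divide_eq)
      ultimately show "(w i \<bullet> ?H (w j))\<^sup>2 / ((w i \<bullet> ?H (w i)) * (w j \<bullet> ?H (w j)))
        = t j * (w j \<bullet> ?H (w i))\<^sup>2 / ((w i \<bullet> ?H (w i)) * b)"
        by simp
    qed
    also have "\<dots> \<le> (w i \<bullet> ?H (w i)) / ((w i \<bullet> ?H (w i)) * b)"
      using g[OF i] b
      by (intro divide_right_mono frame_inv_sum_squares[where t=t, OF t]) simp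
    also have "\<dots> = 1 / b" using g[OF i] by simp
    finally show ?thesis .
  qed
  then show ?thesis
    using linear_frame_inv[where t=t and I=I and w=w, OF t] sa pos by (intro exI[of _ ?H]) simp
qed

section \<open>Projection along a subspace\<close>

text \<open>The orthogonal projection onto the complement of \<open>L\<close> serves as a concrete
  model of the quotient by \<open>L\<close>.\<close>

lemma exists_linear_kernel:
  fixes L :: "'a::euclidean_space set"
  assumes "subspace L"
  obtains p where "linear p" "\<And>x. p x = 0 \<longleftrightarrow> x \<in> L" "\<And>x. x - p x \<in> L"
proof -
  obtain B where B: "B \<subseteq> L" "pairwise orthogonal B" "\<And>e. e \<in> B \<Longrightarrow> norm e = 1"
    "independent B" "card B = dim L" "span B = L"
    using orthonormal_basis_subspace[OF assms] by metis
  define q where "q x = (\<Sum>e\<in>B. (x \<bullet> e) *\<^sub>R e)" for x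
  have "linear q"
    by (rule linearI)
      (simp_all add: q_def inner_add_left scaleR_left_distrib sum.distrib scaleR_sum_right)
  then have "linear (\<lambda>x. x - q x)"
    by (intro linear_compose_sub linear_ident)
  moreover have q: "q x \<in> L" for x
    unfolding q_def B(6)[symmetric] by (intro span_sum span_scale span_base)
  moreover have "q x = x" if "x \<in> L" for x
    unfolding q_def using that B independent_imp_finite[OF B(4)]
    by (intro orthonormal_basis_expand) auto
  ultimately show thesis
    by (intro that[of "\<lambda>x. x - q x"]) (auto simp: eq_iff_diff_eq_0[symmetric], metis)
qed

lemma dim_Un_image_le:
  fixes A :: "'a::euclidean_space set"
  assumes "\<And>x. x - p x \<in> span A"
  shows "dim (A \<union> S) \<le> dim A + dim (p ` S)"
proof -
  obtain B where B: "independent B" "A \<subseteq> span B" "B \<subseteq> A" "card B = dim A"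
    using basis_exists[of A] by metis
  obtain C where C: "independent C" "p ` S \<subseteq> span C" "card C = dim (p ` S)"
    using basis_exists[of "p ` S"] by metis
  have fin: "finite B" "finite C"
    using B(1) C(1) independent_imp_finite by auto
  have sp: "span B \<subseteq> span (B \<union> C)" "span C \<subseteq> span (B \<union> C)"
    by (simp_all add: span_mono)
  have "x \<in> span (B \<union> C)" if "x \<in> S" for x
  proof -
    have "x - p x \<in> span (B \<union> C)"
      using assms[of x] sp(1) B(2) span_minimal[of A "span B"] by auto
    moreover have "p x \<in> span (B \<union> C)"
      using that C(2) sp(2) by blast
    ultimately show ?thesis using span_add by fastforce
  qed
  then have "dim (A \<union> S) \<le> card (B \<union> C)"
    using B(2) sp(1) fin by (intro dim_le_card) auto
  also have "\<dots> \<le> dim A + dim (p ` S)"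
    using card_Un_le[of B C] B C by simp
  finally show ?thesis .
qed

section \<open>Correlations of points in one plane\<close>

text \<open>If \<open>a = 0\<close> the Gram-Schmidt coefficient is \<open>0 / 0 = 0\<close>, which is what is needed.\<close>

lemma plane_coordinates:
  fixes H :: "'a::euclidean_space \<Rightarrow> 'a"
  assumes H: "linear H" "\<And>x y. x \<bullet> H y = H x \<bullet> y" "\<And>x. x \<noteq> 0 \<Longrightarrow> 0 < x \<bullet> H x"
    and w: "\<And>i. i \<in> S \<Longrightarrow> w i \<in> span {a, b}"
  obtains x y where "\<And>i j. i \<in> S \<Longrightarrow> j \<in> S \<Longrightarrow> w i \<bullet> H (w j) = x i * x j + y i * (y j :: real)"
proof -
  note lin = linear_add[OF H(1)] linear_cmul[OF H(1)] linear_diff[OF H(1)] linear_0[OF H(1)]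
  define k where "k = (a \<bullet> H b) / (a \<bullet> H a)"
  define d where "d = b - k *\<^sub>R a"
  have ad: "a \<bullet> H d = 0"
    using H(3)[of a] by (cases "a = 0") (auto simp: d_def k_def lin inner_diff_right)
  have da: "d \<bullet> H a = 0" using ad H(2) by (metis inner_commute)
  have nn: "0 \<le> v \<bullet> H v" for v
    using H(3)[of v] by (cases "v = 0") auto
  have "\<exists>\<alpha> \<beta>. w i = \<alpha> *\<^sub>R a + \<beta> *\<^sub>R d" if i: "i \<in> S" for i
  proof -
    obtain r where "w i - r *\<^sub>R a \<in> span {b}"
      using w[OF i] by (auto simp: span_breakdown_eq)
    then obtain q where "w i - r *\<^sub>R a = q *\<^sub>R b"
      by (auto simp: span_singleton)
    then have "w i = (r + q * k) *\<^sub>R a + q *\<^sub>R d"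
      by (simp add: d_def algebra_simps)
    then show ?thesis by blast
  qed
  then obtain \<alpha> \<beta> where e: "\<And>i. i \<in> S \<Longrightarrow> w i = \<alpha> i *\<^sub>R a + \<beta> i *\<^sub>R d"
    by metis
  \<comment> \<open>Scaling by the lengths of \<open>a\<close> and \<open>d\<close> for the form of
    \<open>H\<close> makes the form a standard dot product in the coordinates.\<close>
  define x where "x i = \<alpha> i * sqrt (a \<bullet> H a)" for i
  define y where "y i = \<beta> i * sqrt (d \<bullet> H d)" for i
  have "w i \<bullet> H (w j) = x i * x j + y i * y j" if "i \<in> S" "j \<in> S" for i j
  proof -
    have "w i \<bullet> H (w j) = \<alpha> i * \<alpha> j * (a \<bullet> H a) + \<beta> i * \<beta> j * (d \<bullet> H d)"
      unfolding e[OF that(1)] e[OF that(2)]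
      by (simp add: lin inner_add_left inner_add_right ad da)
    also have "a \<bullet> H a = (sqrt (a \<bullet> H a))\<^sup>2" using nn by simp
    also have "d \<bullet> H d = (sqrt (d \<bullet> H d))\<^sup>2" using nn by simp
    finally show ?thesis
      by (simp add: x_def y_def power2_eq_square mult_ac)
  qed
  then show thesis by (rule that)
qed

text \<open>\<open>p\<close>, \<open>q\<close>, \<open>r\<close> are the entries of the rank-one
  projections onto the lines of the vectors \<open>(x i, y i)\<close>. The double sum is the squared
  Frobenius norm of the sum of these projections, a symmetric 2 by 2 matrix of trace
  \<open>card S\<close>; already its diagonal contributes at least half the squared trace.\<close>

lemma welch_bound_plane:
  fixes x y :: "'i \<Rightarrow> real"
  assumes pos: "\<And>i. i \<in> S \<Longrightarrow> 0 < x i * x i + y i * y i"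
  shows "(real (card S))\<^sup>2 / 2 \<le>
    (\<Sum>i\<in>S. \<Sum>j\<in>S. (x i * x j + y i * y j)\<^sup>2 / ((x i * x i + y i * y i) * (x j * x j + y j * y j)))"
proof -
  define n where "n i = x i * x i + y i * y i" for i
  define p where "p i = x i * x i / n i" for i
  define q where "q i = y i * y i / n i" for i
  define r where "r i = x i * y i / n i" for i
  have "(x i * x j + y i * y j)\<^sup>2 / (n i * n j) = p i * p j + q i * q j + 2 * (r i * r j)"
    if "i \<in> S" "j \<in> S" for i j
    by (simp add: p_def q_def r_def power2_eq_square add_divide_distrib algebra_simps)
  then have "(\<Sum>i\<in>S. \<Sum>j\<in>S. (x i * x j + y i * y j)\<^sup>2 / (n i * n j))
      = (\<Sum>i\<in>S. \<Sum>j\<in>S. p i * p j + q i * q j + 2 * (r i * r j))"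
    by (intro sum.cong refl) auto
  also have "\<dots> = (sum p S)\<^sup>2 + (sum q S)\<^sup>2 + 2 * (sum r S)\<^sup>2"
    by (simp add: sum.distrib power2_eq_square sum_product)
      (simp add: sum_distrib_left)
  finally have eq: "(\<Sum>i\<in>S. \<Sum>j\<in>S. (x i * x j + y i * y j)\<^sup>2 / (n i * n j))
      = (sum p S)\<^sup>2 + (sum q S)\<^sup>2 + 2 * (sum r S)\<^sup>2" .
  have "sum p S + sum q S = (\<Sum>i\<in>S. 1)"
    unfolding sum.distrib[symmetric]
  proof (rule sum.cong[OF refl])
    fix i assume "i \<in> S"
    then have "n i > 0" using pos by (simp add: n_def)
    then show "p i + q i = 1"
      by (simp add: p_def q_def add_divide_distrib[symmetric] n_def[symmetric])
  qed
  then have "real (card S) = sum p S + sum q S" by simp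
  moreover have "(u + v)\<^sup>2 / 2 \<le> u\<^sup>2 + v\<^sup>2" for u v :: real
    using zero_le_power2[of "u - v"] by (simp add: power2_eq_square algebra_simps)
  ultimately have "(real (card S))\<^sup>2 / 2 \<le> (sum p S)\<^sup>2 + (sum q S)\<^sup>2" by simp
  also have "\<dots> \<le> (\<Sum>i\<in>S. \<Sum>j\<in>S. (x i * x j + y i * y j)\<^sup>2 / (n i * n j))"
    using eq zero_le_power2[of "sum r S"] by linarith
  finally show ?thesis by (simp add: n_def)
qed

lemma sum_offdiag:
  fixes f :: "'i \<Rightarrow> 'i \<Rightarrow> real"
  assumes "finite S" and "\<And>i. i \<in> S \<Longrightarrow> f i i = 1"
  shows "(\<Sum>(i, j)\<in>S \<times> S - Id. f i j) = (\<Sum>i\<in>S. \<Sum>j\<in>S. f i j) - card S"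
proof -
  have "S \<times> S = (S \<times> S - Id) \<union> (\<lambda>i. (i, i)) ` S" by auto
  moreover have "(S \<times> S - Id) \<inter> (\<lambda>i. (i, i)) ` S = {}" by auto
  ultimately have "(\<Sum>(i, j)\<in>S \<times> S. f i j)
      = (\<Sum>(i, j)\<in>S \<times> S - Id. f i j) + (\<Sum>(i, j)\<in>(\<lambda>i. (i, i)) ` S. f i j)"
    using assms(1) by (metis (no_types, lifting) finite_SigmaI finite_Un sum.union_disjoint)
  also have "(\<Sum>(i, j)\<in>(\<lambda>i. (i, i)) ` S. f i j) = card S"
    using assms(2) by (subst sum.reindex) (auto simp: inj_on_def)
  finally show ?thesis
    by (simp add: sum.cartesian_product)
qed

lemma size_eq_sum_fibres:
  assumes "finite Q" and "f ` set_mset M \<subseteq> Q"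
  shows "size M = (\<Sum>P\<in>Q. size {#t \<in># M. f t = P#})"
  using assms(2)
proof (induction M)
  case empty
  show ?case by simp
next
  case (add t M)
  have "(\<Sum>P\<in>Q. size {#u \<in># add_mset t M. f u = P#})
      = (\<Sum>P\<in>Q. size {#u \<in># M. f u = P#} + (if f t = P then 1 else 0))"
    by (intro sum.cong refl) auto
  also have "\<dots> = size M + 1"
    using add assms(1) by (simp add: sum.distrib)
  finally show ?case by simp
qed

lemma independent_pair:
  fixes u v :: "'a::euclidean_space"
  assumes "u \<noteq> 0" and "\<not> (\<exists>L. subspace L \<and> dim L = 1 \<and> u \<in> L \<and> v \<in> L)"
  shows "independent {u, v}"
proof -
  have "v \<notin> span {u}"
    using assms by (metis dim_span dim_singleton insertI1 span_base subspace_span)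
  then have "independent (insert v {u})"
    using assms(1) independent_insertI[of v "{u}"] by simp
  then show ?thesis
    by (simp add: insert_commute)
qed

text \<open>Any two points of \<open>W\<close> span it, so at most one lies in
  \<open>span A\<close>. If none does, the projected points still lie in a span of two vectors and
  the Welch bound applies. If one does, the others project into a single line and all their
  correlations are 1.\<close>

lemma plane_correlation_bound:
  fixes W :: "'a::euclidean_space set" and H p :: "'a \<Rightarrow> 'a" and P A
  defines "S \<equiv> W - span A"
    and "C \<equiv> \<lambda>i j. (p i \<bullet> H (p j))\<^sup>2 / ((p i \<bullet> H (p i)) * (p j \<bullet> H (p j)))"
  assumes H: "linear H" "\<And>x y. x \<bullet> H y = H x \<bullet> y" "\<And>x. x \<noteq> 0 \<Longrightarrow> 0 < x \<bullet> H x"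
    and p: "linear p" "\<And>x. p x = 0 \<longleftrightarrow> x \<in> span A"
    and W: "finite W" "W \<subseteq> P" "3 \<le> card W" "\<not> W \<subseteq> span A"
    and P: "dim P \<le> 2"
    and ind: "\<And>u v. u \<in> W \<Longrightarrow> v \<in> W \<Longrightarrow> u \<noteq> v \<Longrightarrow> independent {u, v}"
  shows "real (card W) - 1 \<le> 4 / 3 * (\<Sum>(i, j)\<in>S \<times> S - Id. C i j)"
proof -
  have pair: "W \<subseteq> span {u, v}" if "u \<in> W" "v \<in> W" "u \<noteq> v" for u v
    using card_ge_dim_independent[of "{u, v}" P] ind[OF that] that P W(2) by auto
  have finS: "finite S" using W(1) by (simp add: S_def)
  have pos: "0 < p i \<bullet> H (p i)" if "i \<in> S" for i
    using that H(3) p(2) by (simp add: S_def)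
  have C1: "C i i = 1" if "i \<in> S" for i
    using pos[OF that] by (simp add: C_def power2_eq_square)
  have off: "(\<Sum>(i, j)\<in>S \<times> S - Id. C i j) = (\<Sum>i\<in>S. \<Sum>j\<in>S. C i j) - card S"
    by (rule sum_offdiag[OF finS C1])
  show ?thesis
  proof (cases "W \<inter> span A = {}")
    case True
    then have SW: "S = W" by (auto simp: S_def)
    obtain T where "T \<subseteq> W" "card T = 2"
      using W(3) obtain_subset_with_card_n[of 2 W] by auto
    then obtain u v where uv: "u \<in> W" "v \<in> W" "u \<noteq> v"
      by (auto simp: card_2_iff)
    have "p i \<in> span {p u, p v}" if "i \<in> S" for i
    proof -
      have "p i \<in> p ` span {u, v}" using that SW pair[OF uv] by blast
      then show ?thesis using linear_span_image[OF p(1), of "{u, v}"] by simp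
    qed
    then obtain x y where xy: "\<And>i j. i \<in> S \<Longrightarrow> j \<in> S \<Longrightarrow> p i \<bullet> H (p j) = x i * x j + y i * y j"
      using plane_coordinates[OF H, of S p "p u" "p v"] by metis
    have "(real (card S))\<^sup>2 / 2 \<le> (\<Sum>i\<in>S. \<Sum>j\<in>S.
        (x i * x j + y i * y j)\<^sup>2 / ((x i * x i + y i * y i) * (x j * x j + y j * y j)))"
    proof (rule welch_bound_plane)
      show "0 < x i * x i + y i * y i" if "i \<in> S" for i
        using pos[OF that] xy[OF that that] by simp
    qed
    also have "\<dots> = (\<Sum>i\<in>S. \<Sum>j\<in>S. C i j)"
      by (intro sum.cong refl) (simp add: C_def xy)
    finally have welch: "(real (card W))\<^sup>2 / 2 - card W \<le> (\<Sum>(i, j)\<in>S \<times> S - Id. C i j)"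
      using off SW by simp
    \<comment> \<open>With \<open>r = card W\<close>, the required inequality rearranges to
      \<open>(r - 3) * (2 * r - 1) \<ge> 0\<close>. Equality at \<open>r = 3\<close> fixes the
      factor 4/3.\<close>
    have "0 \<le> (real (card W) - 3) * (2 * real (card W) - 1)"
      using W(3) by (intro mult_nonneg_nonneg) auto
    then have "real (card W) - 1 \<le> 4 / 3 * ((real (card W))\<^sup>2 / 2 - card W)"
      by (simp add: power2_eq_square algebra_simps)
    also have "\<dots> \<le> 4 / 3 * (\<Sum>(i, j)\<in>S \<times> S - Id. C i j)"
      using welch by (intro mult_left_mono) auto
    finally show ?thesis .
  next
    case False
    then obtain a where a: "a \<in> W" "a \<in> span A" by blast
    have uniq: "v = a" if "v \<in> W" "v \<in> span A" for v
    proof (rule ccontr)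
      assume "v \<noteq> a"
      then have "W \<subseteq> span {a, v}" using pair a that by blast
      also have "\<dots> \<subseteq> span A" using a that by (intro span_minimal) auto
      finally show False using W(4) by blast
    qed
    then have WS: "W = insert a S" "a \<notin> S" using a unfolding S_def by blast+
    then have card: "card W = Suc (card S)" using finS by simp
    then obtain u where u: "u \<in> S" using W(3) by fastforce
    have "\<exists>k. p i = k *\<^sub>R p u" if i: "i \<in> S" for i
    proof -
      have "i \<in> span {a, u}" using pair[of a u] u i WS by auto
      then obtain r where "i - r *\<^sub>R a \<in> span {u}" by (auto simp: span_breakdown_eq)
      then obtain k where "i - r *\<^sub>R a = k *\<^sub>R u" by (auto simp: span_singleton)
      then have "p (i - r *\<^sub>R a) = p (k *\<^sub>R u)" by simp
      then have "p i - r *\<^sub>R p a = k *\<^sub>R p u"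
        by (simp only: linear_diff[OF p(1)] linear_cmul[OF p(1)])
      then show ?thesis using a p(2)[of a] by auto
    qed
    then obtain k where k: "\<And>i. i \<in> S \<Longrightarrow> p i = k i *\<^sub>R p u" by metis
    have "C i j = 1" if ij: "i \<in> S" "j \<in> S" for i j
    proof -
      have g: "p i' \<bullet> H (p j') = k i' * k j' * (p u \<bullet> H (p u))" if "i' \<in> S" "j' \<in> S" for i' j'
        unfolding k[OF that(1)] k[OF that(2)] by (simp add: linear_cmul[OF H(1)])
      have "k i \<noteq> 0" "k j \<noteq> 0" "p u \<bullet> H (p u) \<noteq> 0"
        using pos[OF ij(1)] pos[OF ij(2)] pos[OF u] g ij by auto
      then show ?thesis
        unfolding C_def g[OF ij] g[OF ij(1) ij(1)] g[OF ij(2) ij(2)]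
        by (simp add: power2_eq_square)
    qed
    then have "(\<Sum>(i, j)\<in>S \<times> S - Id. C i j) = real (card S) * card S - card S"
      using off by simp
    \<comment> \<open>With \<open>m = card S = card W - 1\<close>, the claim
      \<open>m \<le> 4 / 3 * (m * m - m)\<close> becomes \<open>m * (4 * m - 7) \<ge> 0\<close>, and
      \<open>m\<close> is at least 2.\<close>
    moreover have "0 \<le> real (card S) * (4 * real (card S) - 7)"
      using W(3) card by (intro mult_nonneg_nonneg) auto
    ultimately show ?thesis using card by (simp add: algebra_simps)
  qed
qed

section \<open>The extremal subset and the final count\<close>

lemma exists_dense_subset:
  fixes V :: "'a::euclidean_space set" and c :: real
  assumes "finite V"
  obtains A where "A \<subseteq> V" "c * dim A \<le> real (card A)"
    "\<And>S. S \<subseteq> V - span A \<Longrightarrow> real (card S) + c * dim A \<le> c * dim (A \<union> S)"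
proof -
  let ?f = "\<lambda>B. real (card B) - c * dim B"
  have fin: "finite (?f ` Pow V)" using assms by simp
  have "Max (?f ` Pow V) \<in> ?f ` Pow V"
    by (rule Max_in[OF fin]) blast
  then obtain A where A: "A \<subseteq> V" "Max (?f ` Pow V) = ?f A" by blast
  have max: "?f B \<le> ?f A" if "B \<subseteq> V" for B
    using Max_ge[OF fin, of "?f B"] that A(2) by simp
  show thesis
  proof (rule that[OF A(1)])
    \<comment> \<open>Comparing the maximizer with the empty set gives this bound; comparing it with
      \<open>A \<union> S\<close> gives the other.\<close>
    show "c * dim A \<le> real (card A)" using max[of "{}"] by simp
    fix S assume S: "S \<subseteq> V - span A"
    then have "A \<inter> S = {}" using span_superset by blast
    then have "card (A \<union> S) = card A + card S"
      using A(1) S assms by (intro card_Un_disjoint) (auto intro: finite_subset)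
    then show "real (card S) + c * dim A \<le> c * dim (A \<union> S)"
      using max[of "A \<union> S"] A(1) S by (simp add: Diff_subset[THEN order_trans[rotated]])
  qed
qed

theorem mainTheorem16:
  fixes V :: "'a::euclidean_space set" and E :: "'a set multiset" and lam :: real
  assumes "finite V" and "V \<noteq> {}" and "0 \<notin> V"
    and "\<And>u v. u \<in> V \<Longrightarrow> v \<in> V \<Longrightarrow> u \<noteq> v \<Longrightarrow>
           \<not> (\<exists>L. subspace L \<and> dim L = 1 \<and> u \<in> L \<and> v \<in> L)"
    and "\<And>t. t \<in># E \<Longrightarrow> card t = 3 \<and> t \<subseteq> V \<and>
           (\<exists>L. subspace L \<and> dim L = 2 \<and> t \<subseteq> L)"
    and "\<And>W. W \<subseteq> V \<Longrightarrow> W \<noteq> {} \<Longrightarrow> dim (span W) \<le> 2 \<Longrightarrow>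
           size (triples_in E W) \<le> card W - 1"
    and "lam > 0"
  shows "\<exists>W. W \<subseteq> V \<and>
           real (size E) - real (size (triples_in E W)) < lam * real (card V) \<and>
           real (dim (span W)) \<le> 12 * real (card V) / lam"
proof -
  note fin = assms(1) and triple = assms(5) and sparse = assms(6) and lam = assms(7)
  have ind: "independent {u, v}" if "u \<in> V" "v \<in> V" "u \<noteq> v" for u v
    using independent_pair[of u v] assms(3,4) that by blast
  define c where "c = lam / 12"
  \<comment> \<open>The value of \<open>b\<close> makes \<open>4 / 3 * (1 / b)\<close> equal to
    \<open>lam\<close>, and with this \<open>c\<close> the product \<open>b * c\<close> is
    1/9.\<close>
  define b where "b = 4 / (3 * lam)"
  have c: "c > 0" and b: "b > 0" "b * c < 1" "1 / b = 3 / 4 * lam"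
    using lam by (simp_all add: c_def b_def)
  obtain A where A: "A \<subseteq> V" "c * dim A \<le> real (card A)"
    "\<And>S. S \<subseteq> V - span A \<Longrightarrow> real (card S) + c * dim A \<le> c * dim (A \<union> S)"
    using exists_dense_subset[OF fin, of c] by metis
  obtain p where p: "linear p" "\<And>x. p x = 0 \<longleftrightarrow> x \<in> span A" "\<And>x. x - p x \<in> span A"
    using exists_linear_kernel[OF subspace_span] by metis
  define I where "I = V - span A"
  have finI: "finite I" using fin by (simp add: I_def)
  have p0: "p i \<noteq> 0" if "i \<in> I" for i
    using that p(2) by (simp add: I_def)
  have dim: "real (card S) \<le> c * real (dim (p ` S))" if "S \<subseteq> I" for S
  proof -
    have "c * dim (A \<union> S) \<le> c * (dim A + dim (p ` S))"
      using dim_Un_image_le[OF p(3), of S] c by (intro mult_left_mono) linarith+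
    then show ?thesis
      using A(3)[of S] that by (simp add: I_def distrib_left)
  qed
  obtain H where H: "linear H" "\<And>x y. x \<bullet> H y = H x \<bullet> y" "\<And>x. x \<noteq> 0 \<Longrightarrow> 0 < x \<bullet> H x"
    and small: "\<And>i. i \<in> I \<Longrightarrow>
      (\<Sum>j\<in>I. (p i \<bullet> H (p j))\<^sup>2 / ((p i \<bullet> H (p i)) * (p j \<bullet> H (p j)))) \<le> 1 / b"
    using exists_small_correlations[of I p c b, OF finI p0 dim b(1,2)] by blast
  define C where "C i j = (p i \<bullet> H (p j))\<^sup>2 / ((p i \<bullet> H (p i)) * (p j \<bullet> H (p j)))" for i j
  have pos: "0 < p i \<bullet> H (p i)" if "i \<in> I" for i
    using H(3) p0[OF that] by blast
  define M where "M = {#t \<in># E. \<not> t \<subseteq> V \<inter> span A#}"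
  have M: "t \<in># E" "t \<subseteq> V" "card t = 3" "\<not> t \<subseteq> span A" "dim (span t) \<le> 2" if "t \<in># M" for t
  proof -
    show t: "t \<in># E" using that by (simp add: M_def)
    then obtain L where L: "dim L = 2" "t \<subseteq> L" using triple by blast
    show "dim (span t) \<le> 2" using dim_subset[OF L(2)] L(1) by (simp add: dim_span)
    show "t \<subseteq> V" "card t = 3" using triple[OF t] by auto
    then show "\<not> t \<subseteq> span A" using that by (auto simp: M_def)
  qed
  define Q where "Q = span ` set_mset M"
  define D where "D P = (V \<inter> P - span A) \<times> (V \<inter> P - span A) - Id" for P
  \<comment> \<open>All triples with span \<open>P\<close> lie in \<open>V \<inter> P\<close>, so
    the sparsity hypothesis bounds their number by \<open>card (V \<inter> P) - 1\<close>, the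
    quantity controlled by \<open>plane_correlation_bound\<close>.\<close>
  have plane: "real (size {#t \<in># M. span t = P#}) \<le> 4 / 3 * (\<Sum>(i, j)\<in>D P. C i j)"
    if "P \<in> Q" for P
  proof -
    obtain t where t: "t \<in># M" "P = span t" using \<open>P \<in> Q\<close> unfolding Q_def by blast
    have tP: "t \<subseteq> V \<inter> P" using M(2)[OF t(1)] t(2) span_superset by blast
    have P2: "dim P \<le> 2" using M(5)[OF t(1)] t(2) by simp
    have c3: "3 \<le> card (V \<inter> P)"
      using card_mono[OF _ tP] fin M(3)[OF t(1)] by simp
    have "{#t \<in># M. span t = P#} \<subseteq># triples_in E (V \<inter> P)"
      unfolding triples_in_def
      using M(2) span_superset by (intro filter_mset_mono_strong) (auto simp: M_def)
    then have "size {#t \<in># M. span t = P#} \<le> size (triples_in E (V \<inter> P))"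
      by (rule size_mset_mono)
    also have "\<dots> \<le> card (V \<inter> P) - 1"
    proof (rule sparse)
      show "V \<inter> P \<noteq> {}" using c3 by auto
      show "dim (span (V \<inter> P)) \<le> 2"
        using P2 dim_subset[of "V \<inter> P" P] by (simp add: dim_span)
    qed simp
    finally have "real (size {#t \<in># M. span t = P#}) \<le> real (card (V \<inter> P)) - 1"
      using c3 by linarith
    also have "\<dots> \<le> 4 / 3 * (\<Sum>(i, j)\<in>D P. C i j)"
      unfolding D_def C_def
      by (rule plane_correlation_bound[OF H p(1,2) _ _ c3 _ P2])
        (use fin tP M(4)[OF t(1)] ind in auto)
    finally show ?thesis .
  qed
  have disj: "D P \<inter> D P' = {}" if PP: "P \<in> Q" "P' \<in> Q" "P \<noteq> P'" for P P'
  proof (rule ccontr)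
    assume "D P \<inter> D P' \<noteq> {}"
    then obtain u v where uv: "u \<in> V" "v \<in> V" "u \<noteq> v" "u \<in> P \<inter> P'" "v \<in> P \<inter> P'"
      by (auto simp: D_def)
    \<comment> \<open>An independent pair in a subspace of dimension at most 2 spans it, so a shared
      pair would determine the plane.\<close>
    have "X = span {u, v}" if "X \<in> Q" "u \<in> X" "v \<in> X" for X
    proof
      obtain t where t: "t \<in># M" "X = span t" using \<open>X \<in> Q\<close> unfolding Q_def by blast
      show "span {u, v} \<subseteq> X" using that t(2) by (intro span_minimal) auto
      show "X \<subseteq> span {u, v}"
        using that M(5)[OF t(1)] t(2) uv(3) ind[OF uv(1-3)]
        by (intro card_ge_dim_independent) auto
    qed
    then show False using PP uv by blast
  qed
  have finQ: "finite Q" by (simp add: Q_def)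
  have finD: "finite (D P)" for P using fin by (simp add: D_def)
  have "real (size M) = (\<Sum>P\<in>Q. real (size {#t \<in># M. span t = P#}))"
    using size_eq_sum_fibres[OF finQ, of span M] by (simp add: Q_def)
  also have "\<dots> \<le> (\<Sum>P\<in>Q. 4 / 3 * (\<Sum>(i, j)\<in>D P. C i j))"
    by (intro sum_mono plane)
  also have "\<dots> = 4 / 3 * (\<Sum>(i, j)\<in>(\<Union>P\<in>Q. D P). C i j)"
    unfolding sum_distrib_left[symmetric] using finQ finD disj
    by (subst sum.UNION_disjoint) auto
  also have "\<dots> \<le> 4 / 3 * (\<Sum>(i, j)\<in>I \<times> I - Id. C i j)"
  proof (intro mult_left_mono sum_mono2)
    show "finite (I \<times> I - Id)" using finI by simp
    show "(\<Union>P\<in>Q. D P) \<subseteq> I \<times> I - Id" by (auto simp: D_def I_def)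
    show "0 \<le> (case x of (i, j) \<Rightarrow> C i j)" if "x \<in> I \<times> I - Id - (\<Union>P\<in>Q. D P)" for x
      using that pos by (auto simp: C_def less_imp_le)
  qed simp
  also have "(\<Sum>(i, j)\<in>I \<times> I - Id. C i j) = (\<Sum>i\<in>I. \<Sum>j\<in>I. C i j) - card I"
    by (rule sum_offdiag[OF finI]) (use pos in \<open>force simp: C_def power2_eq_square\<close>)
  also have "4 / 3 * \<dots> \<le> 4 / 3 * ((\<Sum>i\<in>I. 3 / 4 * lam) - card I)"
    using small b(3) by (intro mult_left_mono diff_right_mono sum_mono) (simp_all add: C_def)
  finally have M_le: "real (size M) \<le> lam * card I - 4 / 3 * card I"
    by (simp add: algebra_simps)
  have "card I \<le> card V" using fin by (simp add: I_def card_mono)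
  have "0 < card V" using fin assms(2) by (simp add: card_gt_0_iff)
  \<comment> \<open>Strictness comes from the removed diagonal if \<open>I\<close> is nonempty, and
    from \<open>lam * card V > 0\<close> otherwise.\<close>
  have M_less: "real (size M) < lam * card V"
  proof (cases "card I = 0")
    case True
    then show ?thesis using M_le lam \<open>0 < card V\<close> by simp
  next
    case False
    moreover have "lam * card I \<le> lam * card V"
      using lam \<open>card I \<le> card V\<close> by simp
    ultimately show ?thesis using M_le by linarith
  qed
  have "E = triples_in E (V \<inter> span A) + M"
    unfolding triples_in_def M_def by (rule multiset_partition)
  then have "size E = size (triples_in E (V \<inter> span A)) + size M"
    by (metis size_union)
  then have "real (size E) - real (size (triples_in E (V \<inter> span A))) < lam * card V"
    using M_less by simp
  moreover have "real (dim (span (V \<inter> span A))) \<le> 12 * card V / lam"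
  proof -
    have "dim (span (V \<inter> span A)) \<le> dim A"
      using dim_subset[of "V \<inter> span A" "span A"] by (simp add: dim_span)
    then have "lam * dim (span (V \<inter> span A)) \<le> lam * dim A"
      using lam by simp
    also have "\<dots> \<le> 12 * card V"
      using A(2) card_mono[OF fin A(1)] by (simp add: c_def)
    finally show ?thesis
      using lam by (simp add: pos_le_divide_eq mult.commute[of _ lam])
  qed
  ultimately show ?thesis
    by (intro exI[of _ "V \<inter> span A"] conjI) simp_all
qed

end
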